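(* Let $f:\mathbb{R}\to(0,\infty)$ be a continuous density that is nonincreasing on $(-\infty,0]$ and nondecreasing on $[0,\infty)$, and let $0<V_1\le V_2\le V_3$. Then every perimeter-minimizing triple bubble on $\mathbb{R}$ with density $f$ and prescribed volumes $V_1,V_2,V_3$ is, up to reflection, of one of the following ten forms: (1) $\mid R_2\mid R_1\mid R_3\mid$, $\ \mid R_1\mid R_2\mid R_3\mid$, $\ \mid R_1\mid R_3\mid R_2\mid$; (2) $\mid R_3^\ell\mid R_1\mid R_2\mid R_3^r\mid$, $\ \mid R_2^\ell\mid R_1\mid R_3\mid R_2^r\mid$; (3) $\mid R_2\mid R_3^\ell\mid R_1\mid R_3^r\mid$, $\ \mid R_1\mid R_3^\ell\mid R_2\mid R_3^r\mid$, $\ \mid R_3\mid R_2^\ell\mid R_1\mid R_2^r\mid$; (4) $\mid R_3^\ell\mid R_2^\ell\mid R_1\mid R_2^r\mid R_3^r\mid$, $\ \mid R_2^\ell\mid R_3^\ell\mid R_1\mid R_3^r\mid R_2^r\mid$.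
   Context: A density on $\mathbb{R}$ is a function $f:\mathbb{R}\to(0,\infty)$; the volume of a set $E$ is $\int_E f\,dx$. A triple bubble with prescribed volumes $V_1,V_2,V_3$ is a triple of sets $(E_1,E_2,E_3)$ with pairwise disjoint interiors, each a finite union of compact intervals of positive length, such that $E_a$ has volume $V_a$; $E_a$ is called bubble $a$. The components of bubble $a$ are the connected components (maximal intervals) of $E_a$. The boundary points are the points of $\partial E_1\cup\partial E_2\cup\partial E_3$ (each counted once), and the perimeter is the sum of $f(x)$ over all boundary points $x$. A triple bubble is perimeter minimizing if its perimeter is minimal among all triple bubbles with the same prescribed volumes. The notation $\mid I_1\mid I_2\mid\dots\mid I_m\mid$ denotes a multi-bubble whose components are exactly the compact intervals $I_1,\dots,I_m$, which are contiguous from left to right in this order (the right endpoint of $I_j$ is the left endpoint of $I_{j+1}$). If bubble $a$ has exactly one component, it is denoted $R_a$; if it has exactly two components, $R_a^\ell$ and $R_a^r$ denote its left and right components. "Up to reflection" means that the left-to-right sequence of bubble labels of the (contiguous) components, or its reversal, is the one displayed. *)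

theory Defs
  imports "HOL-Analysis.Analysis"
begin

definition volume :: "(real \<Rightarrow> real) \<Rightarrow> real set \<Rightarrow> real" where
  "volume f A = integral A f"

definition finite_interval_union :: "real set \<Rightarrow> bool" where
  "finite_interval_union A \<longleftrightarrow>
     (\<exists>I. finite I \<and> (\<forall>(a, b)\<in>I. a < b) \<and> A = (\<Union>(a, b)\<in>I. {a..b}))"

text \<open>A triple of sets is encoded as a function on the naturals of which only the
  values at 1, 2, 3 matter; likewise for the prescribed volumes.\<close>

definition triple_bubble ::
  "(real \<Rightarrow> real) \<Rightarrow> (nat \<Rightarrow> real) \<Rightarrow> (nat \<Rightarrow> real set) \<Rightarrow> bool" where
  "triple_bubble f V E \<longleftrightarrow>
     (\<forall>a\<in>{1,2,3}. finite_interval_union (E a) \<and> volume f (E a) = V a) \<and>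
     (\<forall>a\<in>{1,2,3}. \<forall>b\<in>{1,2,3}. a \<noteq> b \<longrightarrow> interior (E a) \<inter> interior (E b) = {})"

text \<open>Summing over the union of the frontiers counts a point shared by two bubbles once.\<close>

definition perimeter :: "(real \<Rightarrow> real) \<Rightarrow> (nat \<Rightarrow> real set) \<Rightarrow> real" where
  "perimeter f E = (\<Sum>x\<in>(\<Union>a\<in>{1,2,3}. frontier (E a)). f x)"

definition perimeter_minimizing ::
  "(real \<Rightarrow> real) \<Rightarrow> (nat \<Rightarrow> real) \<Rightarrow> (nat \<Rightarrow> real set) \<Rightarrow> bool" where
  "perimeter_minimizing f V E \<longleftrightarrow>
     triple_bubble f V E \<and> (\<forall>F. triple_bubble f V F \<longrightarrow> perimeter f E \<le> perimeter f F)"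

text \<open>The components, from left to right, are the contiguous intervals
  \<open>{p 0..p 1}, {p 1..p 2}, \<dots>\<close>, the \<open>j\<close>-th of which belongs to bubble \<open>w ! j\<close>.
  The superscripts left and right of a two-component bubble are implicit in the
  order of the two occurrences of its label in \<open>w\<close>.\<close>

definition has_form :: "(nat \<Rightarrow> real set) \<Rightarrow> nat list \<Rightarrow> bool" where
  "has_form E w \<longleftrightarrow>
     (\<exists>p :: nat \<Rightarrow> real. (\<forall>j<length w. p j < p (Suc j)) \<and>
        (\<forall>a\<in>{1,2,3}. components (E a) = {{p j..p (Suc j)} | j. j < length w \<and> w ! j = a}))"

definition has_form_up_to_reflection :: "(nat \<Rightarrow> real set) \<Rightarrow> nat list \<Rightarrow> bool" where
  "has_form_up_to_reflection E w \<longleftrightarrow> has_form E w \<or> has_form E (rev w)"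

end

theory Submission
  imports Defs
begin

text \<open>The idea is to measure length by volume. Let \<open>F\<close> be the antiderivative of the density \<open>f\<close> with
  \<open>F 0 = 0\<close>. As \<open>f\<close> is bounded below by \<open>f 0 > 0\<close>, it is an increasing bijection of the line
  (\<open>volume_coordinate\<close>). In the coordinate \<open>F x\<close> the volume of an interval is its length, and the
  cost \<open>g = f \<circ> inv F\<close> of a boundary point is again nonincreasing up to the origin and nondecreasing
  after it. The boundary points of a triple bubble are cut points \<open>p 0 < \<dots> < p m\<close>, and the labels
  of the pieces between them, with \<open>0\<close> for a gap, form a word \<open>w\<close> (\<open>bubble_as_cells\<close>).

  All comparisons keep the word and shift blocks of consecutive cut points. Such a shift
  lengthens the piece before the block and shortens the piece after it by the same amount, so it
  preserves the volumes if both belong to the same bubble. When a piece collapses, two cut points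
  coincide and one boundary point is saved. As \<open>g\<close> is positive, no shift of a minimizer can
  move its cut points only towards the origin and collapse a piece (\<open>inward_move\<close>). The
  contradiction comes from the saved point, as \<open>g\<close> may be constant on intervals. This gives
  four rules for the word of a minimizer.

  \<^item> There are no gaps: a gap could be closed towards the origin (\<open>no_gap\<close>).
  \<^item> No bubble has two pieces on the same side of the origin, because the inner one could be
    emptied into the outer one (\<open>distinct_left\<close>, \<open>distinct_right\<close>).
  \<^item> Two bubbles that have pieces on both sides are nested in the same order on both sides, because
    otherwise both inner pieces could feed the outer ones simultaneously (\<open>no_crossing\<close>).
  \<^item> Between two pieces of one bubble there is a piece shorter than the left one, and a piece
    shorter than the right one (\<open>short_piece_between_left\<close>, \<open>short_piece_between_right\<close>). Otherwise
    one of the two could be emptied into the other so that the new cut points interlace the old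
    ones, and interlacing with one point fewer is cheaper for a function that decreases and then
    increases (\<open>interlacing\<close>). In particular no two neighbours have the same label.

  If the origin lies inside a piece whose bubble recurs on one side, the part on that side can be
  handed over without increasing the perimeter. So the word is a concatenation of two words
  without repetitions that have no crossing (\<open>clean_cut\<close>), and only the words \<open>abc\<close>, \<open>abac\<close>,
  \<open>caba\<close>, \<open>abca\<close> and \<open>abcba\<close> remain (\<open>candidate_words\<close>). In these, by the fourth rule, a
  bubble with two pieces encloses a bubble of smaller volume, and the centre of \<open>abcba\<close> has
  the smallest volume. This leaves the ten forms up to reflection.\<close>

section \<open>Words and cut points\<close>

text \<open>The \<open>n\<close>-th piece is \<open>{p n..p (Suc n)}\<close>, it carries the label \<open>w ! n\<close>,
  and \<open>p\<close> has one more relevant value than \<open>w\<close> has letters.\<close>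

definition vol :: "nat list \<Rightarrow> (nat \<Rightarrow> real) \<Rightarrow> nat \<Rightarrow> real" where
  "vol w p a = (\<Sum>n | n < length w \<and> w ! n = a. p (Suc n) - p n)"

text \<open>All comparisons keep the word, so only competitors with the same word are admitted.
  Their pieces may collapse to points: the sum over the image \<open>q ` {..length w}\<close> counts
  coinciding cut points once, so a collapse saves perimeter. Label \<open>0\<close> stands for a gap, whose
  length is unconstrained.\<close>

definition minimal :: "(real \<Rightarrow> real) \<Rightarrow> nat list \<Rightarrow> (nat \<Rightarrow> real) \<Rightarrow> bool" where
  "minimal g w p \<longleftrightarrow>
     (\<forall>n<length w. p n < p (Suc n)) \<and>
     (\<forall>q. (\<forall>n<length w. q n \<le> q (Suc n)) \<longrightarrow>
          (\<forall>a\<in>{1,2,3}. vol w q a = vol w p a) \<longrightarrow>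
          (\<Sum>n\<le>length w. g (p n)) \<le> (\<Sum>x\<in>q ` {..length w}. g x))"

lemma minimal_strict: "minimal g w p \<Longrightarrow> n < length w \<Longrightarrow> p n < p (Suc n)"
  by (simp add: minimal_def)

lemma minimal_le:
  assumes "minimal g w p"
    and "\<And>n. n < length w \<Longrightarrow> q n \<le> q (Suc n)"
    and "\<And>a. a \<in> {1,2,3} \<Longrightarrow> vol w q a = vol w p a"
  shows "(\<Sum>n\<le>length w. g (p n)) \<le> (\<Sum>x\<in>q ` {..length w}. g x)"
  using assms unfolding minimal_def by blast

lemma chain_mono:
  fixes p :: "nat \<Rightarrow> real"
  assumes "\<And>n. n < m \<Longrightarrow> p n \<le> p (Suc n)" and "i \<le> j" "j \<le> m"
  shows "p i \<le> p j"
  using assms(2,3)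
proof (induction j rule: dec_induct)
  case (step n)
  then show ?case using assms(1)[of n] by simp
qed simp

lemma chain_strict_mono:
  fixes p :: "nat \<Rightarrow> real"
  assumes "\<And>n. n < m \<Longrightarrow> p n < p (Suc n)" and "i < j" "j \<le> m"
  shows "p i < p j"
proof -
  have "p (Suc i) \<le> p j"
    by (rule chain_mono[of m]) (use assms in \<open>simp_all add: less_imp_le\<close>)
  then show ?thesis using assms(1)[of i] assms(2,3) by simp
qed

section \<open>Shifting a block of cut points\<close>

text \<open>The cut points that move are those to the right of piece \<open>i\<close> and to the left of
  piece \<open>j\<close>, together with all cut points in between; hence piece \<open>i\<close> gains the length \<open>t\<close>,
  piece \<open>j\<close> loses it, and the pieces between are translated.\<close>

definition shift :: "nat \<Rightarrow> nat \<Rightarrow> real \<Rightarrow> (nat \<Rightarrow> real) \<Rightarrow> nat \<Rightarrow> real" where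
  "shift i j t p n = p n + (if i < n \<and> n \<le> j then t else 0)"

lemma shift_length:
  assumes "i < j"
  shows "shift i j t p (Suc n) - shift i j t p n =
           (p (Suc n) - p n) + (if n = i then t else 0) - (if n = j then t else 0)"
  using assms by (auto simp: shift_def)

lemma vol_shift:
  assumes "i < j" "j < length w"
  shows "vol w (shift i j t p) a =
           vol w p a + (if w ! i = a then t else 0) - (if w ! j = a then t else 0)"
proof -
  have *: "(\<Sum>n | n < length w \<and> w ! n = a. if n = k then t else 0) =
             (if w ! k = a then t else 0)" if "k < length w" for k
    using that by (subst sum.delta) auto
  show ?thesis
    unfolding vol_def shift_length[OF assms(1)]
    using assms by (simp add: sum.distrib sum_subtractf *)
qed

section \<open>Moves that save perimeter\<close>

locale valley =
  fixes g :: "real \<Rightarrow> real"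
  assumes pos: "g x > 0"
    and decreasing: "x \<le> y \<Longrightarrow> y \<le> 0 \<Longrightarrow> g y \<le> g x"
    and increasing: "0 \<le> x \<Longrightarrow> x \<le> y \<Longrightarrow> g x \<le> g y"
begin

lemma inward: "x \<le> y \<and> y \<le> 0 \<or> 0 \<le> y \<and> y \<le> x \<Longrightarrow> g y \<le> g x"
  using decreasing increasing by blast

text \<open>One of the \<open>p n\<close> can be dropped: a point \<open>r n < 0\<close> is compared with its left
  neighbour \<open>p n\<close> and a point \<open>r n \<ge> 0\<close> with its right neighbour \<open>p (Suc n)\<close>. No \<open>p n\<close> is used
  twice, because the \<open>r n\<close> increase.\<close>

lemma interlacing:
  assumes "\<And>n. a \<le> n \<Longrightarrow> n < b \<Longrightarrow> p n \<le> r n \<and> r n \<le> p (Suc n)" and "a \<le> b"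
  shows "(\<Sum>n=a..<b. g (r n)) < (\<Sum>n=a..b. g (p n))"
  using assms(2,1)
proof (induction b rule: dec_induct)
  case base
  then show ?case by (simp add: pos)
next
  case (step b)
  note prem = step.prems
  show ?case
  proof (cases "r b \<ge> 0")
    case True
    then have "g (r b) \<le> g (p (Suc b))"
      using step by (intro increasing) auto
    then show ?thesis using step by simp
  next
    case False
    have "r n \<le> r b" if "n \<le> b" "a \<le> n" for n
      using that
    proof (induction n rule: inc_induct)
      case (step k)
      then have "r k \<le> r (Suc k)"
        using step.prems prem[of k] prem[of "Suc k"] by simp
      with step show ?case by simp
    qed simp
    then have "r n \<le> 0" if "a \<le> n" "n < Suc b" for n
      using that False order_trans[of "r n" "r b" 0] by simp
    then have "g (r n) \<le> g (p n)" if "n \<in> {a..<Suc b}" for n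
      using step.prems that by (intro decreasing) auto
    then have "(\<Sum>n=a..<Suc b. g (r n)) \<le> (\<Sum>n=a..<Suc b. g (p n))"
      by (rule sum_mono)
    also have "\<dots> < (\<Sum>n=a..Suc b. g (p n))"
      using step.hyps pos[of "p (Suc b)"] by (simp add: atLeastLessThanSuc_atLeastAtMost)
    finally show ?thesis .
  qed
qed

context
  fixes w :: "nat list" and p :: "nat \<Rightarrow> real"
  assumes min: "minimal g w p"
begin

lemma cut_less: "i < j \<Longrightarrow> j \<le> length w \<Longrightarrow> p i < p j"
  using minimal_strict[OF min] by (rule chain_strict_mono)

lemma cut_mono: "i \<le> j \<Longrightarrow> j \<le> length w \<Longrightarrow> p i \<le> p j"
  using cut_less[of i j] by (cases "i = j") auto

text \<open>A competitor with two coinciding cut points is charged for one of them only, and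
  either of the two may be chosen as the one that is free.\<close>

lemma degenerate_competitor:
  assumes "\<And>n. n < length w \<Longrightarrow> q n \<le> q (Suc n)"
    and "\<And>a. a \<in> {1,2,3} \<Longrightarrow> vol w q a = vol w p a"
    and "k \<le> length w" "l \<le> length w" "k \<noteq> l" "q k = q l"
  shows "(\<Sum>n\<le>length w. g (p n)) \<le> (\<Sum>n\<in>{..length w} - {k}. g (q n))"
proof -
  have "(\<Sum>n\<le>length w. g (p n)) \<le> (\<Sum>x\<in>q ` {..length w}. g x)"
    by (intro minimal_le[OF min] assms(1,2))
  also have "q ` {..length w} = q ` ({..length w} - {k})"
  proof -
    have "q k \<in> q ` ({..length w} - {k})"
      unfolding assms(6) using assms(4,5) by (intro imageI) auto
    moreover have "{..length w} = insert k ({..length w} - {k})"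
      using assms(3) by auto
    ultimately show ?thesis by (metis image_insert insert_absorb)
  qed
  also have "(\<Sum>x\<in>q ` ({..length w} - {k}). g x) \<le> (\<Sum>n\<in>{..length w} - {k}. g (q n))"
    using sum_image_le[of "{..length w} - {k}" g q] pos by (simp add: less_imp_le o_def)
  finally show ?thesis .
qed

text \<open>Moving cut points towards the origin does not increase the perimeter, so the new
  position is again minimal; it cannot have a collapsed piece, since the saved point would make
  the decrease strict. Strictness can come from the saved point only, as \<open>g\<close> may be
  constant on intervals.\<close>

lemma inward_move:
  assumes mono: "\<And>n. n < length w \<Longrightarrow> q n \<le> q (Suc n)"
    and vol: "\<And>a. a \<in> {1,2,3} \<Longrightarrow> vol w q a = vol w p a"
    and inw: "\<And>n. n \<le> length w \<Longrightarrow> p n \<le> q n \<and> q n \<le> 0 \<or> 0 \<le> q n \<and> q n \<le> p n \<or> q n = p n"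
  shows "minimal g w q"
proof -
  have le: "g (q n) \<le> g (p n)" if "n \<le> length w" for n
    using inw[OF that] inward[of "p n" "q n"] by auto
  have "q n < q (Suc n)" if n: "n < length w" for n
  proof (rule ccontr)
    assume "\<not> q n < q (Suc n)"
    then have "q n = q (Suc n)" using mono[OF n] by simp
    then have "(\<Sum>n\<le>length w. g (p n)) \<le> (\<Sum>j\<in>{..length w} - {n}. g (q j))"
      using n by (intro degenerate_competitor[of q n "Suc n"] mono vol) auto
    also have "\<dots> \<le> (\<Sum>j\<in>{..length w} - {n}. g (p j))"
      by (intro sum_mono le) simp
    also have "\<dots> < (\<Sum>j\<le>length w. g (p j))"
      using n pos[of "p n"] by (subst sum_diff1) auto
    finally show False by simp
  qed
  moreover have "(\<Sum>n\<le>length w. g (q n)) \<le> (\<Sum>n\<le>length w. g (p n))"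
    by (intro sum_mono le) simp
  moreover have "(\<Sum>n\<le>length w. g (p n)) \<le> (\<Sum>x\<in>r ` {..length w}. g x)"
    if "\<forall>n<length w. r n \<le> r (Suc n)" "\<forall>a\<in>{1,2,3}. vol w r a = vol w q a" for r
    using that vol by (intro minimal_le[OF min]) auto
  ultimately show ?thesis
    unfolding minimal_def by (intro conjI allI impI; (blast intro: order_trans)?)
qed

corollary degenerate_inward_move:
  assumes "\<And>n. n < length w \<Longrightarrow> q n \<le> q (Suc n)"
    and "\<And>a. a \<in> {1,2,3} \<Longrightarrow> vol w q a = vol w p a"
    and "\<And>n. n \<le> length w \<Longrightarrow> p n \<le> q n \<and> q n \<le> 0 \<or> 0 \<le> q n \<and> q n \<le> p n \<or> q n = p n"
    and "k < length w" "q k = q (Suc k)"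
  shows False
  using minimal_strict[OF inward_move[of q], of k] assms by simp

lemma shift_mono:
  assumes "i < j" "j < length w" "p i - p (Suc i) \<le> t" "t \<le> p (Suc j) - p j" "n < length w"
  shows "shift i j t p n \<le> shift i j t p (Suc n)"
  using shift_length[OF assms(1), of t p n] cut_mono[of n "Suc n"] assms by (auto split: if_splits)

text \<open>A gap can be closed by pulling its two ends to the point of the gap that is nearest
  to the origin, which moves everything else inwards.\<close>

lemma no_gap:
  assumes i: "i < length w"
  shows "w ! i \<in> {1,2,3}"
proof (rule ccontr)
  assume gap: "w ! i \<notin> {1,2,3}"
  \<comment> \<open>the point of the gap that is nearest to the origin\<close>
  define c where "c = max (p i) (min 0 (p (Suc i)))"
  define q where "q n = (if n \<le> i then p n + (c - p i) else p n - (p (Suc i) - c))" for n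
  have pi: "p i < p (Suc i)" using cut_less i by simp
  show False
  proof (rule degenerate_inward_move[of q i])
    show "q i = q (Suc i)" by (simp add: q_def)
    show "i < length w" by fact
    fix n assume n: "n < length w"
    show "q n \<le> q (Suc n)"
      using cut_mono[of n "Suc n"] n pi by (cases n i rule: linorder_cases) (auto simp: q_def)
  next
    fix a :: nat assume "a \<in> {1,2,3}"
    then show "vol w q a = vol w p a"
      unfolding vol_def
    proof (intro sum.cong refl)
      fix n assume "n \<in> {n. n < length w \<and> w ! n = a}"
      then have "n \<noteq> i" using gap \<open>a \<in> {1,2,3}\<close> by auto
      then show "q (Suc n) - q n = p (Suc n) - p n"
        by (cases n i rule: linorder_cases) (simp_all add: q_def)
    qed
  next
    fix n assume n: "n \<le> length w"
    show "p n \<le> q n \<and> q n \<le> 0 \<or> 0 \<le> q n \<and> q n \<le> p n \<or> q n = p n"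
    proof (cases "n \<le> i")
      case True
      then show ?thesis
        using cut_mono[of n i] i pi by (auto simp: q_def c_def max_def min_def)
    next
      case False
      then show ?thesis
        using cut_mono[of "Suc i" n] n pi by (auto simp: q_def c_def max_def min_def)
    qed
  qed
qed

lemma repeated_shift_vol:
  assumes "i < j" "j < length w" "w ! i = w ! j"
  shows "vol w (shift i j t p) a = vol w p a"
  using assms by (simp add: vol_shift)

text \<open>Of two pieces of one bubble to the right of the origin, the inner one can be emptied
  into the outer one; the pieces between them slide inwards.\<close>

lemma distinct_right:
  assumes "i < j" "j < length w" "0 \<le> p i"
  shows "w ! i \<noteq> w ! j"
proof
  assume eq: "w ! i = w ! j"
  show False
  proof (rule degenerate_inward_move[of "shift i j (p i - p (Suc i)) p" i])
    show "shift i j (p i - p (Suc i)) p n \<le> shift i j (p i - p (Suc i)) p (Suc n)"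
      if "n < length w" for n
      using that assms cut_mono[of i "Suc i"] cut_mono[of j "Suc j"] by (intro shift_mono) auto
    show "vol w (shift i j (p i - p (Suc i)) p) a = vol w p a" for a
      by (rule repeated_shift_vol) (use assms eq in auto)
    fix n assume n: "n \<le> length w"
    show "p n \<le> shift i j (p i - p (Suc i)) p n \<and> shift i j (p i - p (Suc i)) p n \<le> 0 \<or>
      0 \<le> shift i j (p i - p (Suc i)) p n \<and> shift i j (p i - p (Suc i)) p n \<le> p n \<or>
      shift i j (p i - p (Suc i)) p n = p n"
      using assms cut_mono[of "Suc i" n] cut_mono[of i "Suc i"] n by (auto simp: shift_def)
  qed (use assms in \<open>auto simp: shift_def\<close>)
qed

lemma distinct_left:
  assumes "i < j" "j < length w" "p (Suc j) \<le> 0"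
  shows "w ! i \<noteq> w ! j"
proof
  assume eq: "w ! i = w ! j"
  show False
  proof (rule degenerate_inward_move[of "shift i j (p (Suc j) - p j) p" j])
    show "shift i j (p (Suc j) - p j) p n \<le> shift i j (p (Suc j) - p j) p (Suc n)"
      if "n < length w" for n
      using that assms cut_mono[of i "Suc i"] cut_mono[of j "Suc j"] by (intro shift_mono) auto
    show "vol w (shift i j (p (Suc j) - p j) p) a = vol w p a" for a
      by (rule repeated_shift_vol) (use assms eq in auto)
    fix n assume n: "n \<le> length w"
    show "p n \<le> shift i j (p (Suc j) - p j) p n \<and> shift i j (p (Suc j) - p j) p n \<le> 0 \<or>
      0 \<le> shift i j (p (Suc j) - p j) p n \<and> shift i j (p (Suc j) - p j) p n \<le> p n \<or>
      shift i j (p (Suc j) - p j) p n = p n"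
      using assms cut_mono[of n j] cut_mono[of j "Suc j"] n by (auto simp: shift_def)
  qed (use assms in \<open>auto simp: shift_def\<close>)
qed

text \<open>A piece that contains the origin can hand its right part over to a piece of the same
  bubble further right. No piece collapses, so this is no contradiction, but it makes the origin
  a cut point.\<close>

lemma transfer_right:
  assumes "i < j" "j < length w" "w ! i = w ! j" "p i \<le> 0" "0 \<le> p (Suc i)"
  shows "minimal g w (shift i j (- p (Suc i)) p)"
proof (rule inward_move)
  show "shift i j (- p (Suc i)) p n \<le> shift i j (- p (Suc i)) p (Suc n)" if "n < length w" for n
    using that assms cut_mono[of j "Suc j"] by (intro shift_mono) auto
  show "vol w (shift i j (- p (Suc i)) p) a = vol w p a" for a
    by (rule repeated_shift_vol) (use assms in auto)
  fix n assume n: "n \<le> length w"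
  show "p n \<le> shift i j (- p (Suc i)) p n \<and> shift i j (- p (Suc i)) p n \<le> 0 \<or>
    0 \<le> shift i j (- p (Suc i)) p n \<and> shift i j (- p (Suc i)) p n \<le> p n \<or>
    shift i j (- p (Suc i)) p n = p n"
    using assms cut_mono[of "Suc i" n] n by (auto simp: shift_def)
qed

lemma transfer_left:
  assumes "i < j" "j < length w" "w ! i = w ! j" "p j \<le> 0" "0 \<le> p (Suc j)"
  shows "minimal g w (shift i j (- p j) p)"
proof (rule inward_move)
  show "shift i j (- p j) p n \<le> shift i j (- p j) p (Suc n)" if "n < length w" for n
    using that assms cut_mono[of i "Suc i"] by (intro shift_mono) auto
  show "vol w (shift i j (- p j) p) a = vol w p a" for a
    by (rule repeated_shift_vol) (use assms in auto)
  fix n assume n: "n \<le> length w"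
  show "p n \<le> shift i j (- p j) p n \<and> shift i j (- p j) p n \<le> 0 \<or>
    0 \<le> shift i j (- p j) p n \<and> shift i j (- p j) p n \<le> p n \<or>
    shift i j (- p j) p n = p n"
    using assms cut_mono[of n j] n by (auto simp: shift_def)
qed

text \<open>Suppose bubble \<open>a\<close> lies outside bubble \<open>c\<close> on the left of the origin and inside it on
  the right. Feeding the outer piece of \<open>a\<close> from the inner piece of \<open>c\<close> on the left, and the outer
  piece of \<open>c\<close> from the inner piece of \<open>a\<close> on the right, at the same rate, preserves both volumes
  and moves all cut points inwards until one of the inner pieces is used up.\<close>

lemma no_crossing:
  assumes ij: "i < j" "p (Suc j) \<le> 0" and kl: "k < l" "l < length w" "0 \<le> p k" and jk: "j < k"
  shows "\<not> (w ! i = w ! k \<and> w ! j = w ! l)"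
proof
  assume eq: "w ! i = w ! k \<and> w ! j = w ! l"
  define t where "t = min (p (Suc j) - p j) (p (Suc k) - p k)"
  define q where "q = shift i j t (shift k l (- t) p)"
  have t: "0 \<le> t" "t \<le> p (Suc j) - p j" "t \<le> p (Suc k) - p k"
    using cut_mono[of j "Suc j"] cut_mono[of k "Suc k"] assms by (auto simp: t_def)
  have len: "q (Suc n) - q n = p (Suc n) - p n + (if n = i then t else 0) - (if n = j then t else 0)
      - (if n = k then t else 0) + (if n = l then t else 0)" for n
    unfolding q_def shift_length[OF ij(1)] shift_length[OF kl(1)] by simp
  \<comment> \<open>the inner piece that is used up\<close>
  define m where "m = (if t = p (Suc j) - p j then j else k)"
  show False
  proof (rule degenerate_inward_move[of q m])
    show "m < length w" using assms by (auto simp: m_def)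
    have "q (Suc m) - q m = 0"
      using assms unfolding len by (auto simp: m_def t_def min_def)
    then show "q m = q (Suc m)" by simp
    show "q n \<le> q (Suc n)" if "n < length w" for n
      using len[of n] t cut_mono[of n "Suc n"] that assms by (auto split: if_splits)
    show "vol w q a = vol w p a" for a
      unfolding q_def using assms eq by (subst vol_shift, simp, simp)+ auto
    fix n assume n: "n \<le> length w"
    show "p n \<le> q n \<and> q n \<le> 0 \<or> 0 \<le> q n \<and> q n \<le> p n \<or> q n = p n"
      using assms cut_mono[of n j] cut_mono[of k "Suc k"] cut_mono[of "Suc k" n] n t 
      by (auto simp: q_def shift_def)
  qed
qed

text \<open>Only the cut points \<open>Suc i, \<dots>, Suc j\<close> need to be compared when a block is shifted and
  one of them becomes free.\<close>

lemma sum_shift_less: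
  assumes "i < j" "j < length w" and k: "i < k" "k \<le> Suc j" 
    and less: "(\<Sum>n\<in>{Suc i..Suc j} - {k}. g (shift i j t p n)) < (\<Sum>n\<in>{Suc i..Suc j}. g (p n))"
  shows "(\<Sum>n\<in>{..length w} - {k}. g (shift i j t p n)) < (\<Sum>n\<le>length w. g (p n))"
proof -
  let ?B = "{Suc i..Suc j}" and ?A = "{..length w} - {Suc i..Suc j}"
  have "{..length w} - {k} = ?A \<union> (?B - {k})" using assms by auto
  then have "(\<Sum>n\<in>{..length w} - {k}. g (shift i j t p n)) =
      (\<Sum>n\<in>?A. g (shift i j t p n)) + (\<Sum>n\<in>?B - {k}. g (shift i j t p n))"
    by (simp only:) (rule sum.union_disjoint, auto)
  also have "(\<Sum>n\<in>?A. g (shift i j t p n)) = (\<Sum>n\<in>?A. g (p n))"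
    by (intro sum.cong) (auto simp: shift_def)
  also have "(\<Sum>n\<in>?A. g (p n)) + (\<Sum>n\<in>?B - {k}. g (shift i j t p n)) <
      (\<Sum>n\<in>?A. g (p n)) + (\<Sum>n\<in>?B. g (p n))"
    using less by simp
  also have "\<dots> = (\<Sum>n\<le>length w. g (p n))"
    using assms by (subst sum.subset_diff[of ?B "{..length w}"]) auto
  finally show ?thesis .
qed

text \<open>If every piece strictly between pieces \<open>i\<close> and \<open>j\<close> of one bubble is at least as long as
  piece \<open>j\<close>, then emptying piece \<open>j\<close> into piece \<open>i\<close> moves each cut point of the block at most to
  its right neighbour. The new cut points interlace the old ones and are one fewer.\<close>

lemma short_piece_between_right:
  assumes "i < j" "j < length w" "w ! i = w ! j"
  shows "\<exists>n>i. n < j \<and> p (Suc n) - p n < p (Suc j) - p j"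
proof (rule ccontr)
  assume "\<not> ?thesis"
  then have long: "p (Suc j) - p j \<le> p (Suc n) - p n" if "i < n" "n < j" for n
    using that by force
  define t where "t = p (Suc j) - p j"
  have t: "0 \<le> t" using cut_mono[of j "Suc j"] assms by (simp add: t_def)
  have B: "{Suc i..Suc j} - {Suc j} = {Suc i..<Suc j}" by auto
  have *: "shift i j t p n = p n + t" if "n \<in> {Suc i..<Suc j}" for n
    using that by (auto simp: shift_def)
  have "(\<Sum>n\<le>length w. g (p n)) \<le> (\<Sum>n\<in>{..length w} - {Suc j}. g (shift i j t p n))"
  proof (rule degenerate_competitor[of _ _ j])
    show "shift i j t p n \<le> shift i j t p (Suc n)" if "n < length w" for n
      using that assms t cut_mono[of i "Suc i"] by (intro shift_mono) (auto simp: t_def)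
    show "vol w (shift i j t p) a = vol w p a" for a
      by (rule repeated_shift_vol) (use assms in auto)
  qed (use assms in \<open>auto simp: shift_def t_def\<close>)
  also have "\<dots> < (\<Sum>n\<le>length w. g (p n))"
  proof (rule sum_shift_less)
    show "(\<Sum>n\<in>{Suc i..Suc j} - {Suc j}. g (shift i j t p n)) < (\<Sum>n = Suc i..Suc j. g (p n))"
      unfolding B
    proof (rule interlacing)
      fix n assume n: "Suc i \<le> n" "n < Suc j"
      then show "p n \<le> shift i j t p n \<and> shift i j t p n \<le> p (Suc n)"
        using long[of n] t by (cases "n = j") (auto simp: shift_def t_def)
    qed (use assms in auto)
  qed (use assms in auto)
  finally show False by simp
qed

lemma short_piece_between_left:
  assumes "i < j" "j < length w" "w ! i = w ! j"
  shows "\<exists>n>i. n < j \<and> p (Suc n) - p n < p (Suc i) - p i"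
proof (rule ccontr)
  assume "\<not> ?thesis"
  then have long: "p (Suc i) - p i \<le> p (Suc n) - p n" if "i < n" "n < j" for n
    using that by force
  define t where "t = p i - p (Suc i)"
  have t: "t \<le> 0" using cut_mono[of i "Suc i"] assms by (simp add: t_def)
  have "(\<Sum>n\<le>length w. g (p n)) \<le> (\<Sum>n\<in>{..length w} - {Suc i}. g (shift i j t p n))"
  proof (rule degenerate_competitor[of _ _ i])
    show "shift i j t p n \<le> shift i j t p (Suc n)" if "n < length w" for n
      using that assms t cut_mono[of j "Suc j"] by (intro shift_mono) (auto simp: t_def)
    show "vol w (shift i j t p) a = vol w p a" for a
      by (rule repeated_shift_vol) (use assms in auto)
  qed (use assms in \<open>auto simp: shift_def t_def\<close>)
  also have "\<dots> < (\<Sum>n\<le>length w. g (p n))"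
  proof (rule sum_shift_less)
    have "{Suc i..Suc j} - {Suc i} = {Suc (Suc i)..<Suc (Suc j)}" by auto
    then have "(\<Sum>n\<in>{Suc i..Suc j} - {Suc i}. g (shift i j t p n)) =
        (\<Sum>n=Suc i..<Suc j. g (shift i j t p (Suc n)))"
      by (simp only: sum.shift_bounds_Suc_ivl)
    also have "\<dots> < (\<Sum>n = Suc i..Suc j. g (p n))"
    proof (rule interlacing)
      fix n assume n: "Suc i \<le> n" "n < Suc j"
      then show "p n \<le> shift i j t p (Suc n) \<and> shift i j t p (Suc n) \<le> p (Suc n)"
        using long[of n] t cut_mono[of n "Suc n"] assms by (cases "n = j") (auto simp: shift_def t_def)
    qed (use assms in auto)
    finally show "(\<Sum>n\<in>{Suc i..Suc j} - {Suc i}. g (shift i j t p n)) <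
      (\<Sum>n = Suc i..Suc j. g (p n))" .
  qed (use assms in auto)
  finally show False by simp
qed

lemma adjacent_distinct: "Suc n < length w \<Longrightarrow> w ! n \<noteq> w ! Suc n"
  using short_piece_between_right[of n "Suc n"] by auto

end

end

section \<open>Cutting the word at the origin\<close>

context valley
begin

text \<open>The rules for one side and the crossing rule apply to the two halves of the word if the
  origin is the cut point between them, or if one half is empty and all pieces lie on one side.\<close>

lemma clean_cut_at:
  assumes min: "minimal g w p" and k: "k \<le> length w"
    and left: "k = 0 \<or> p k \<le> 0" and right: "k = length w \<or> 0 \<le> p k"
  shows "distinct (take k w) \<and> distinct (drop k w) \<and>
    (\<forall>i j a b. i < j \<and> j < k \<and> k \<le> a \<and> a < b \<and> b < length w \<longrightarrow>
       \<not> (w ! i = w ! a \<and> w ! j = w ! b))"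
proof -
  have l: "p (Suc j) \<le> 0" if "j < k" for j
    using cut_mono[OF min, of "Suc j" k] that k left by auto
  have r: "0 \<le> p a" if "k \<le> a" "a < length w" for a
    using cut_mono[OF min, of k a] that right by auto
  have "distinct (take k w)"
    unfolding distinct_conv_nth
  proof (intro allI impI)
    fix i j assume "i < length (take k w)" "j < length (take k w)" "i \<noteq> j"
    then show "take k w ! i \<noteq> take k w ! j"
      using distinct_left[OF min, of i j] distinct_left[OF min, of j i] l[of i] l[of j]
      by (cases i j rule: linorder_cases) auto
  qed
  moreover have "distinct (drop k w)"
    unfolding distinct_conv_nth
  proof (intro allI impI)
    fix i j assume ij: "i < length (drop k w)" "j < length (drop k w)" "i \<noteq> j"
    then have "k + i < length w" "k + j < length w" by auto
    with ij show "drop k w ! i \<noteq> drop k w ! j"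
      using distinct_right[OF min, of "k + i" "k + j"] distinct_right[OF min, of "k + j" "k + i"]
        r[of "k + i"] r[of "k + j"]
      by (cases i j rule: linorder_cases) auto
  qed
  moreover have "\<not> (w ! i = w ! a \<and> w ! j = w ! b)"
    if "i < j" "j < k" "k \<le> a" "a < b" "b < length w" for i j a b
    using no_crossing[OF min, of i j a b] l[of j] r[of a] that by simp
  ultimately show ?thesis by blast
qed

text \<open>If the origin lies inside a piece, that piece can be reduced to its part on one side
  when its bubble recurs on the other, which makes the origin a cut point. If its bubble does not
  recur, the piece repeats no letter and takes part in no crossing, so the word can be cut on
  either side of it.\<close>

lemma clean_cut:
  assumes min: "minimal g w p"
  shows "\<exists>k. distinct (take k w) \<and> distinct (drop k w) \<and>
    (\<forall>i j a b. i < j \<and> j < k \<and> k \<le> a \<and> a < b \<and> b < length w \<longrightarrow>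
       \<not> (w ! i = w ! a \<and> w ! j = w ! b))"
proof -
  consider "0 \<le> p 0" | "p (length w) \<le> 0" | "p 0 < 0" "0 < p (length w)" by linarith
  then show ?thesis
  proof cases
    case 1
    then show ?thesis using clean_cut_at[OF min, of 0] by blast
  next
    case 2
    then show ?thesis using clean_cut_at[OF min, of "length w"] by blast
  next
    case 3
    \<comment> \<open>the origin lies in the piece that ends at the first nonnegative cut point\<close>
    define n where "n = (LEAST n. 0 \<le> p n)"
    have n: "0 \<le> p n" "n \<le> length w"
      unfolding n_def using 3 by (auto intro: LeastI[of _ "length w"] Least_le)
    have "n \<noteq> 0" using n(1) 3 by (metis not_less)
    then obtain i where i: "n = Suc i" by (cases n) auto
    have "\<not> 0 \<le> p i"
      using not_less_Least[of i "\<lambda>n. 0 \<le> p n"] i unfolding n_def by simp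
    with n i have pi: "p i < 0" "0 \<le> p (Suc i)" and il: "i < length w" by auto
    show ?thesis
    proof (cases "\<exists>j>i. j < length w \<and> w ! i = w ! j")
      case True
      then obtain j where j: "i < j" "j < length w" "w ! i = w ! j" by blast
      then have "minimal g w (shift i j (- p (Suc i)) p)"
        using pi by (intro transfer_right[OF min]) auto
      from clean_cut_at[OF this, of "Suc i"] il j show ?thesis
        by (auto simp: shift_def)
    next
      case no_right: False
      show ?thesis
      proof (cases "\<exists>j<i. w ! j = w ! i")
        case True
        then obtain j where j: "j < i" "w ! j = w ! i" by blast
        then have "minimal g w (shift j i (- p i) p)"
          using pi il by (intro transfer_left[OF min]) auto
        from clean_cut_at[OF this, of i] il j show ?thesis
          by (auto simp: shift_def)
      next
        case no_left: False
        have l: "p (Suc j) \<le> 0" if "j < i" for j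
          using cut_mono[OF min, of "Suc j" i] that il pi by auto
        have r: "0 \<le> p a" if "i < a" "a < length w" for a
          using cut_mono[OF min, of "Suc i" a] that pi by auto
        have "distinct (take (Suc i) w)"
          unfolding distinct_conv_nth
        proof (intro allI impI)
          have *: "w ! a \<noteq> w ! b" if "a < b" "b < Suc i" for a b
            using distinct_left[OF min, of a b] l[of b] il no_left that
            by (cases "b = i") auto
          fix a b assume "a < length (take (Suc i) w)" "b < length (take (Suc i) w)" "a \<noteq> b"
          then show "take (Suc i) w ! a \<noteq> take (Suc i) w ! b"
            using *[of a b] *[of b a] by (cases a b rule: linorder_cases) auto
        qed
        moreover have "distinct (drop (Suc i) w)"
          unfolding distinct_conv_nth
        proof (intro allI impI)
          have *: "w ! a \<noteq> w ! b" if "a < b" "i < a" "b < length w" for a b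
            using distinct_right[OF min, of a b] r[of a] that by auto
          fix a b assume ab: "a < length (drop (Suc i) w)" "b < length (drop (Suc i) w)" "a \<noteq> b"
          then have "Suc i + a < length w" "Suc i + b < length w" by auto
          with ab show "drop (Suc i) w ! a \<noteq> drop (Suc i) w ! b"
            using *[of "Suc i + a" "Suc i + b"] *[of "Suc i + b" "Suc i + a"]
            by (cases a b rule: linorder_cases) auto
        qed
        moreover have "\<not> (w ! c = w ! a \<and> w ! d = w ! b)"
          if "c < d" "d < Suc i" "Suc i \<le> a" "a < b" "b < length w" for a b c d
          using no_crossing[OF min, of c d a b] l[of d] r[of a] no_right that
          by (cases "d = i") auto
        ultimately show ?thesis by blast
      qed
    qed
  qed
qed

end

section \<open>The admissible words\<close>

context valley
begin

lemma piece_le_vol: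
  assumes "minimal g w p" "n < length w"
  shows "p (Suc n) - p n \<le> vol w p (w ! n)"
  unfolding vol_def using assms cut_mono[OF assms(1)]
  by (intro member_le_sum) auto

lemma piece_eq_vol:
  assumes "n < length w" "\<And>m. m < length w \<Longrightarrow> w ! m = w ! n \<Longrightarrow> m = n"
  shows "vol w p (w ! n) = p (Suc n) - p n"
proof -
  have "{m. m < length w \<and> w ! m = w ! n} = {n}" using assms by auto
  then show ?thesis by (simp add: vol_def)
qed

text \<open>The short piece between two pieces of a bubble is a whole bubble when its letter is
  unrepeated, and then its volume is below that of the enclosing bubble.\<close>

lemma smaller_between:
  assumes min: "minimal g w p" and ij: "i < j" "j < length w" "w ! i = w ! j"
    and single: "\<And>n m. i < n \<Longrightarrow> n < j \<Longrightarrow> m < length w \<Longrightarrow> w ! m = w ! n \<Longrightarrow> m = n"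
  shows "\<exists>n>i. n < j \<and> vol w p (w ! n) < vol w p (w ! i)"
proof -
  obtain n where n: "i < n" "n < j" "p (Suc n) - p n < p (Suc i) - p i"
    using short_piece_between_left[OF min ij] by blast
  then have "vol w p (w ! n) < vol w p (w ! i)"
    using piece_eq_vol[of n w p] single[of n] piece_le_vol[OF min, of i] ij by simp
  with n show ?thesis by blast
qed

text \<open>Applied to the inner pair, the rule makes the centre shorter than both pieces of \<open>b\<close>.
  So whichever piece is short for the outer pair, the centre is short as well.\<close>

lemma nested_centre:
  assumes min: "minimal g w p" and w: "w = [a, b, c, b, a]" and "c \<noteq> a"
  shows "vol w p c < vol w p b \<and> vol w p c < vol w p a"
proof -
  define l where "l n = p (Suc n) - p n" for n
  have "w ! 1 \<noteq> w ! 2" using adjacent_distinct[OF min, of 1] w by (simp add: numeral_2_eq_2)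
  then have bc: "b \<noteq> c" by (simp add: w)
  have c: "vol w p c = l 2"
  proof -
    have "m = 2" if "m < length w" "w ! m = w ! 2" for m
    proof -
      have "m \<in> {0, 1, 2, 3, 4}" using that(1) by (auto simp: w)
      then show ?thesis using that(2) bc \<open>c \<noteq> a\<close> by (auto simp: w)
    qed
    then show ?thesis using piece_eq_vol[of 2 w p] by (simp add: w l_def)
  qed
  have "\<exists>n>1. n < 3 \<and> l n < l 1" 
    using short_piece_between_left[OF min, of 1 3] by (simp add: w l_def)
  then have c1: "l 2 < l 1" by (metis One_nat_def Suc_1 less_antisym less_trans_Suc numeral_3_eq_3 not_less_eq)
  have "\<exists>n>1. n < 3 \<and> l n < l 3" 
    using short_piece_between_right[OF min, of 1 3] by (simp add: w l_def)
  then have c3: "l 2 < l 3" by (metis One_nat_def Suc_1 less_antisym less_trans_Suc numeral_3_eq_3 not_less_eq)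
  obtain n where n: "0 < n" "n < 4" "l n < l 0"
    using short_piece_between_left[OF min, of 0 4] by (auto simp: w l_def)
  then have "n = 1 \<or> n = 2 \<or> n = 3" by auto
  with c1 c3 n(3) have "l 2 < l 0" by auto
  then show ?thesis
    using c c1 piece_le_vol[OF min, of 0] piece_le_vol[OF min, of 1] by (simp add: w l_def)
qed

end

text \<open>By the rule for one side, each half of a word cut at the origin is one of these.\<close>

definition half_words :: "nat list list" where
  "half_words = [[], [1], [2], [3], [1,2], [1,3], [2,1], [2,3], [3,1], [3,2],
     [1,2,3], [1,3,2], [2,1,3], [2,3,1], [3,1,2], [3,2,1]]"

lemma distinct_words:
  assumes "distinct l" "set l \<subseteq> {1,2,3::nat}"
  shows "l \<in> set half_words"
proof -
  have "length l \<le> 3"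
    using assms distinct_card[of l] card_mono[of "{1,2,3::nat}" "set l"] by simp
  then consider "l = []" | a where "l = [a]" | a b where "l = [a, b]"
    | a b c where "l = [a, b, c]"
    by (cases l rule: list.exhaust; cases "tl l" rule: list.exhaust;
        cases "tl (tl l)" rule: list.exhaust) auto
  then show ?thesis
  proof cases
    case 1
    then show ?thesis by (simp add: half_words_def)
  next
    case (2 a)
    then show ?thesis using assms by (auto simp: half_words_def)
  next
    case (3 a b)
    then have "a \<in> {1,2,3}" "b \<in> {1,2,3}" "a \<noteq> b" using assms by simp_all
    then show ?thesis unfolding 3 half_words_def by (elim insertE emptyE; simp)
  next
    case (4 a b c)
    then have "a \<in> {1,2,3}" "b \<in> {1,2,3}" "c \<in> {1,2,3}" "a \<noteq> b" "a \<noteq> c" "b \<noteq> c"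
      using assms by simp_all
    then show ?thesis unfolding 4 half_words_def by (elim insertE emptyE; simp)
  qed
qed

definition forms :: "nat list list" where
  "forms = [[2,1,3], [1,2,3], [1,3,2],
            [3,1,2,3], [2,1,3,2],
            [2,3,1,3], [1,3,2,3], [3,2,1,2],
            [3,2,1,2,3], [2,3,1,3,2]]"

text \<open>The concatenations of two half words that use all three letters, have no equal
  neighbours and no crossing.\<close>

definition candidates :: "nat list list" where
  "candidates =
    concat [[[a, b, c], [a, b, a, c], [c, a, b, a], [a, b, c, a], [a, b, c, b, a]].
      (a, b, c) \<leftarrow> [(1,2,3), (1,3,2), (2,1,3), (2,3,1), (3,1,2), (3,2,1)]]"

lemma candidate_words:
  assumes "distinct l" "distinct r" and letters: "set (l @ r) = {1,2,3::nat}"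
    and adj: "\<And>n. Suc n < length (l @ r) \<Longrightarrow> (l @ r) ! n \<noteq> (l @ r) ! Suc n"
    and cross: "\<And>i j a b. i < j \<Longrightarrow> j < length l \<Longrightarrow> a < b \<Longrightarrow> b < length r \<Longrightarrow>
      \<not> (l ! i = r ! a \<and> l ! j = r ! b)"
  shows "l @ r \<in> set candidates"
proof -
  \<comment> \<open>nested conditionals instead of implications stop the evaluation at the first failing condition\<close>
  have enum: "\<forall>l\<in>set half_words. \<forall>r\<in>set half_words.
    if set (l @ r) = {1,2,3} then
    if list_all (\<lambda>n. (l @ r) ! n \<noteq> (l @ r) ! Suc n) [0..<length (l @ r) - 1] then
    if list_all (\<lambda>j. list_all (\<lambda>i. list_all (\<lambda>b. list_all (\<lambda>a.
         \<not> (l ! i = r ! a \<and> l ! j = r ! b)) [0..<b]) [0..<length r]) [0..<j]) [0..<length l] then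
    l @ r \<in> set candidates
    else True else True else True"
    by code_simp
  have 1: "list_all (\<lambda>n. (l @ r) ! n \<noteq> (l @ r) ! Suc n) [0..<length (l @ r) - 1]"
    using adj by (simp add: list_all_iff del: nth_append length_append)
  have 2: "list_all (\<lambda>j. list_all (\<lambda>i. list_all (\<lambda>b. list_all (\<lambda>a.
         \<not> (l ! i = r ! a \<and> l ! j = r ! b)) [0..<b]) [0..<length r]) [0..<j]) [0..<length l]"
    unfolding list_all_iff set_upt by (intro ballI) (rule cross; simp)
  have "l \<in> set half_words" and "r \<in> set half_words"
    using assms(1,2) letters by (intro distinct_words; auto)+
  note w = bspec[OF bspec[OF enum this(1)] this(2)]
  have X if "if A then if B then if C then X else True else True else True" A B C for A B C X
    using that by simp
  from this[OF w letters 1 2] show ?thesis .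
qed

text \<open>The hypothesis is what the short piece rule says about labels instead of volumes. It
  applies only if the letters between the equal ones are unrepeated, so it cannot see the outer
  pair of \<open>[1,3,2,3,1]\<close>.\<close>

lemma candidate_filter:
  assumes w: "w \<in> set candidates"
    and between: "\<And>i j. i < j \<Longrightarrow> j < length w \<Longrightarrow> w ! i = w ! j \<Longrightarrow>
      (\<And>n. i < n \<Longrightarrow> n < j \<Longrightarrow> count_list w (w ! n) = 1) \<Longrightarrow>
      \<exists>n>i. n < j \<and> w ! n < w ! i"
  shows "w \<in> set forms \<or> rev w \<in> set forms \<or> w = [1,3,2,3,1]"
proof -
  have enum: "\<forall>w \<in> set candidates.
    if list_all (\<lambda>j. list_all (\<lambda>i.
         if w ! i = w ! j then
         if list_all (\<lambda>n. count_list w (w ! n) = 1) [Suc i..<j] then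
         list_ex (\<lambda>n. w ! n < w ! i) [Suc i..<j] else True else True) [0..<j]) [0..<length w] then
    w \<in> set forms \<or> rev w \<in> set forms \<or> w = [1,3,2,3,1]
    else True"
    by code_simp
  have 1: "list_all (\<lambda>j. list_all (\<lambda>i.
         if w ! i = w ! j then
         if list_all (\<lambda>n. count_list w (w ! n) = 1) [Suc i..<j] then
         list_ex (\<lambda>n. w ! n < w ! i) [Suc i..<j] else True else True) [0..<j]) [0..<length w]"
    unfolding list_all_iff list_ex_iff
  proof (intro ballI)
    have *: "if A then if B then C else True else True" if "A \<Longrightarrow> B \<Longrightarrow> C" for A B C
      using that by simp
    fix j i
    assume ij: "j \<in> set [0..<length w]" "i \<in> set [0..<j]"
    show "if w ! i = w ! j then
         if \<forall>n\<in>set [Suc i..<j]. count_list w (w ! n) = 1 then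
         \<exists>n\<in>set [Suc i..<j]. w ! n < w ! i else True else True"
    proof (rule *)
      assume "w ! i = w ! j" "\<forall>n\<in>set [Suc i..<j]. count_list w (w ! n) = 1"
      with ij have "\<exists>n>i. n < j \<and> w ! n < w ! i"
        by (intro between) simp_all
      then show "\<exists>n\<in>set [Suc i..<j]. w ! n < w ! i"
        unfolding set_upt by (meson atLeastLessThan_iff Suc_leI)
    qed
  qed
  have X if "if A then X else True" A for A X
    using that by simp
  from this[OF bspec[OF enum w] 1] show ?thesis .
qed

lemma count_list_1_unique:
  assumes "count_list w (w ! n) = 1" "n < length w" "m < length w" "w ! m = w ! n"
  shows "m = n"
proof (rule ccontr)
  assume "m \<noteq> n"
  then have "card {m, n} \<le> card {i. i < length w \<and> w ! n = w ! i}"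
    using assms by (intro card_mono) auto
  then show False
    using assms(1) \<open>m \<noteq> n\<close> by (simp add: count_list_eq_length_filter length_filter_conv_card)
qed

context valley
begin

text \<open>Since the volumes increase with the labels, a smaller volume means a smaller label.\<close>

theorem minimal_word:
  assumes min: "minimal g w p"
    and V: "0 < vol w p 1" "vol w p 1 \<le> vol w p 2" "vol w p 2 \<le> vol w p 3"
  shows "w \<in> set forms \<or> rev w \<in> set forms"
proof -
  obtain k where k: "distinct (take k w)" "distinct (drop k w)"
    "\<And>i j a b. i < j \<Longrightarrow> j < k \<Longrightarrow> k \<le> a \<Longrightarrow> a < b \<Longrightarrow> b < length w \<Longrightarrow>
       \<not> (w ! i = w ! a \<and> w ! j = w ! b)"
    using clean_cut[OF min] by blast
  have sub: "set w \<subseteq> {1,2,3}"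
    using no_gap[OF min] by (metis in_set_conv_nth subsetI)
  have "a \<in> set w" if "vol w p a \<noteq> 0" for a
  proof (rule ccontr)
    assume "a \<notin> set w"
    then have "{n. n < length w \<and> w ! n = a} = {}" by auto
    then show False using that unfolding vol_def by (metis sum.empty)
  qed
  then have letters: "set w = {1,2,3}" using sub V by fastforce
  have "take k w @ drop k w \<in> set candidates"
  proof (rule candidate_words)
    fix i j a b
    assume "i < j" "j < length (take k w)" "a < b" "b < length (drop k w)"
    then show "\<not> (take k w ! i = drop k w ! a \<and> take k w ! j = drop k w ! b)"
      using k(3)[of i j "k + a" "k + b"] by auto
  next
    fix n assume "Suc n < length (take k w @ drop k w)"
    then show "(take k w @ drop k w) ! n \<noteq> (take k w @ drop k w) ! Suc n"
      unfolding append_take_drop_id by (rule adjacent_distinct[OF min])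
  qed (use k(1,2) letters in simp_all)
  then have "w \<in> set candidates" by simp
  then have "w \<in> set forms \<or> rev w \<in> set forms \<or> w = [1,3,2,3,1]"
  proof (rule candidate_filter)
    fix i j assume ij: "i < j" "j < length w" "w ! i = w ! j"
      and single: "\<And>n. i < n \<Longrightarrow> n < j \<Longrightarrow> count_list w (w ! n) = 1"
    have "m = n" if "i < n" "n < j" "m < length w" "w ! m = w ! n" for n m
      using single[of n] that ij(2) by (intro count_list_1_unique[of w n m]) auto
    then obtain n where n: "i < n" "n < j" "vol w p (w ! n) < vol w p (w ! i)"
      using smaller_between[OF min ij] by blast
    have "w ! n \<in> {1,2,3}" "w ! i \<in> {1,2,3}"
      using no_gap[OF min, of n] no_gap[OF min, of i] n(1,2) ij by simp_all
    then have "w ! n < w ! i" using n(3) V by auto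
    then show "\<exists>n>i. n < j \<and> w ! n < w ! i" using n by blast
  qed
  moreover have "w \<noteq> [1,3,2,3,1]"
    using nested_centre[OF min, of 1 3 2] V by auto
  ultimately show ?thesis by blast
qed

end

section \<open>Volume as a coordinate\<close>

lemma volume_coordinate:
  fixes f :: "real \<Rightarrow> real"
  assumes cont: "continuous_on UNIV f" and c: "0 < c" "\<And>x. c \<le> f x"
  obtains F where "F 0 = 0" "strict_mono F" "surj F"
    "\<And>a b. a \<le> b \<Longrightarrow> (f has_integral (F b - F a)) {a..b}"
proof -
  have "isCont f x" for x
    using cont by (simp add: continuous_on_eq_continuous_at)
  then obtain G where G: "\<And>x. (G has_vector_derivative f x) (at x)"
    using einterval_antiderivative[of "-\<infinity>" "\<infinity>" f] by auto
  define F where "F x = G x - G 0" for x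
  have D: "(F has_vector_derivative f x) (at x)" for x
    unfolding F_def using has_vector_derivative_diff_const[of G "G 0"] G by simp
  have D': "DERIV F x :> f x" for x
    using D by (simp add: has_real_derivative_iff_has_vector_derivative)
  have growth: "c * (y - x) \<le> F y - F x" if "x \<le> y" for x y
  proof (cases "x = y")
    case False
    with that obtain z where "F y - F x = (y - x) * f z"
      using MVT2[of x y F f] D' by auto
    moreover have "(y - x) * c \<le> (y - x) * f z"
      using that c(2) by (intro mult_left_mono) auto
    ultimately show ?thesis by (simp add: mult.commute)
  qed simp
  have F0: "F 0 = 0" by (simp add: F_def)
  show ?thesis
  proof (rule that[of F])
    show "F 0 = 0" by (rule F0)
    show "strict_mono F"
    proof (rule strict_monoI)
      fix x y :: real assume "x < y"
      then have "0 < c * (y - x)" using c by simp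
      with growth[of x y] \<open>x < y\<close> show "F x < F y" by simp
    qed
    show "surj F"
      unfolding surj_def
    proof
      fix y
      \<comment> \<open>by the linear growth of \<open>F\<close>, the values at \<open>- b\<close> and \<open>b\<close> enclose \<open>y\<close>\<close>
      define b where "b = \<bar>y\<bar> / c"
      have b: "0 \<le> b" "c * b = \<bar>y\<bar>" using c by (simp_all add: b_def)
      have "F (- b) \<le> y" "y \<le> F b"
        using growth[of "- b" 0] growth[of 0 b] b F0 by auto
      moreover have "isCont F x" for x using D' by (rule DERIV_isCont)
      ultimately show "\<exists>x. y = F x"
        using IVT[of F "- b" y b] b by auto
    qed
    show "(f has_integral (F b - F a)) {a..b}" if "a \<le> b" for a b
      using that D by (intro fundamental_theorem_of_calculus)
        (auto intro: has_vector_derivative_at_within)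
  qed
qed

section \<open>Triple bubbles as unions of pieces\<close>

text \<open>Collapsed pieces are left out: they could be isolated points, which no union of
  intervals of positive length has.\<close>

definition cells :: "nat list \<Rightarrow> (nat \<Rightarrow> real) \<Rightarrow> nat \<Rightarrow> real set" where
  "cells w x a = (\<Union>n\<in>{n. n < length w \<and> w ! n = a \<and> x n < x (Suc n)}. {x n..x (Suc n)})"

lemma cell_inter:
  fixes x :: "nat \<Rightarrow> real"
  assumes mono: "\<And>n. n < m \<Longrightarrow> x n \<le> x (Suc n)" and "n < m" "k < m" "n \<noteq> k"
  shows "{x n..x (Suc n)} \<inter> {x k..x (Suc k)} \<subseteq> {x (max n k)}"
proof (cases n k rule: linorder_cases)
  case less
  then have "x (Suc n) \<le> x k" using assms by (intro chain_mono[of m x, OF mono]) auto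
  with less show ?thesis by (auto simp: max_def)
next
  case greater
  then have "x (Suc k) \<le> x n" using assms by (intro chain_mono[of m x, OF mono]) auto
  with greater show ?thesis by (auto simp: max_def)
qed (use assms in auto)

lemma has_integral_cells:
  assumes mono: "\<And>n. n < length w \<Longrightarrow> x n \<le> x (Suc n)"
    and int: "\<And>a b. a \<le> b \<Longrightarrow> (f has_integral (F b - F a)) {a..b}"
  shows "(f has_integral vol w (F \<circ> x) a) (cells w x a)"
proof -
  let ?N = "{n. n < length w \<and> w ! n = a \<and> x n < x (Suc n)}"
  have "(f has_integral (\<Sum>n\<in>?N. F (x (Suc n)) - F (x n))) (cells w x a)"
    unfolding cells_def
  proof (rule has_integral_UN)
    show "pairwise (\<lambda>n k. negligible ({x n..x (Suc n)} \<inter> {x k..x (Suc k)})) ?N"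
    proof (rule pairwiseI)
      fix n k assume "n \<in> ?N" "k \<in> ?N" "n \<noteq> k"
      then have "{x n..x (Suc n)} \<inter> {x k..x (Suc k)} \<subseteq> {x (max n k)}"
        by (intro cell_inter[of "length w" x, OF mono]) auto
      then show "negligible ({x n..x (Suc n)} \<inter> {x k..x (Suc k)})"
        by (rule negligible_subset[rotated]) simp
    qed
  qed (use int mono in auto)
  also have "(\<Sum>n\<in>?N. F (x (Suc n)) - F (x n)) = vol w (F \<circ> x) a"
    unfolding vol_def comp_def
  proof (rule sum.mono_neutral_left)
    show "\<forall>n\<in>{n. n < length w \<and> w ! n = a} - ?N. F (x (Suc n)) - F (x n) = 0"
    proof
      fix n assume "n \<in> {n. n < length w \<and> w ! n = a} - ?N"
      then have "x n = x (Suc n)" using mono[of n] by force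
      then show "F (x (Suc n)) - F (x n) = 0" by simp
    qed
  qed auto
  finally show ?thesis .
qed

lemma frontier_cells: "frontier (cells w x a) \<subseteq> x ` {..length w}"
proof -
  let ?N = "{n. n < length w \<and> w ! n = a \<and> x n < x (Suc n)}"
  have "frontier (cells w x a) \<subseteq> (\<Union>C\<in>(\<lambda>n. {x n..x (Suc n)}) ` ?N. frontier C)"
    unfolding cells_def by (rule frontier_Union_subset) auto
  also have "\<dots> \<subseteq> x ` {..length w}"
    by (auto simp: frontier_def)
  finally show ?thesis .
qed

lemma interior_cells_disjoint:
  assumes mono: "\<And>n. n < length w \<Longrightarrow> x n \<le> x (Suc n)" and "a \<noteq> b"
  shows "interior (cells w x a) \<inter> interior (cells w x b) = {}"
proof -
  have "cells w x a \<inter> cells w x b \<subseteq> x ` {..length w}"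
  proof
    fix y assume "y \<in> cells w x a \<inter> cells w x b"
    then obtain n k where nk: "n < length w" "w ! n = a" "k < length w" "w ! k = b"
      "y \<in> {x n..x (Suc n)}" "y \<in> {x k..x (Suc k)}"
      by (auto simp: cells_def)
    then have "n \<noteq> k" using \<open>a \<noteq> b\<close> by auto
    with nk have "y \<in> {x (max n k)}"
      using cell_inter[of "length w" x n k, OF mono] by blast
    moreover have "max n k \<le> length w" using nk by simp
    ultimately show "y \<in> x ` {..length w}" by blast
  qed
  then have "finite (cells w x a \<inter> cells w x b)"
    by (rule finite_subset) simp
  then have "interior (cells w x a \<inter> cells w x b) = {}" by (rule empty_interior_finite)
  then show ?thesis by simp
qed

text \<open>Only an inequality holds for the perimeter, since neighbouring pieces with equal labels
  merge and some cut points are then no boundary points.\<close>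

lemma cells_competitor:
  assumes mono: "\<And>n. n < length w \<Longrightarrow> x n \<le> x (Suc n)"
    and int: "\<And>a b. a \<le> b \<Longrightarrow> (f has_integral (F b - F a)) {a..b}"
    and V: "\<And>a. a \<in> {1,2,3} \<Longrightarrow> vol w (F \<circ> x) a = V a"
    and pos: "\<And>y. 0 \<le> f y"
  shows "triple_bubble f V (cells w x)"
    and "perimeter f (cells w x) \<le> (\<Sum>y\<in>x ` {..length w}. f y)"
proof -
  have "finite_interval_union (cells w x a)" for a
    unfolding finite_interval_union_def cells_def
    by (rule exI[of _ "(\<lambda>n. (x n, x (Suc n))) ` {n. n < length w \<and> w ! n = a \<and> x n < x (Suc n)}"])
      auto
  moreover have "volume f (cells w x a) = V a" if "a \<in> {1,2,3}" for a
    unfolding volume_def V[OF that, symmetric]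
    by (intro integral_unique has_integral_cells mono int)
  ultimately show "triple_bubble f V (cells w x)"
    unfolding triple_bubble_def using interior_cells_disjoint[of w x, OF mono] by blast
  show "perimeter f (cells w x) \<le> (\<Sum>y\<in>x ` {..length w}. f y)"
    unfolding perimeter_def
  proof (rule sum_mono2)
    show "(\<Union>a\<in>{1,2,3}. frontier (cells w x a)) \<subseteq> x ` {..length w}"
      by (intro UN_least frontier_cells)
  qed (use pos in auto)
qed

lemma finite_interval_unionD:
  assumes "finite_interval_union A"
  shows "compact A" "finite (frontier A)"
    "\<And>y. y \<in> A \<Longrightarrow> \<exists>c d. c < d \<and> y \<in> {c..d} \<and> {c..d} \<subseteq> A"
proof -
  obtain I where I: "finite I" "\<And>a b. (a, b) \<in> I \<Longrightarrow> a < b" "A = (\<Union>(a, b)\<in>I. {a..b})"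
    using assms unfolding finite_interval_union_def by blast
  show "compact A" unfolding I(3) using I(1) by (intro compact_UN) auto
  have "frontier A \<subseteq> (\<Union>C\<in>(\<lambda>(a, b). {a..b}) ` I. frontier C)"
    unfolding I(3) by (rule frontier_Union_subset) (use I(1) in auto)
  also have "\<dots> \<subseteq> fst ` I \<union> snd ` I"
    by (force simp: frontier_def)
  finally show "finite (frontier A)" by (rule finite_subset) (use I(1) in auto)
  show "\<exists>c d. c < d \<and> y \<in> {c..d} \<and> {c..d} \<subseteq> A" if "y \<in> A" for y
    using that I(2) unfolding I(3) by blast
qed

lemma frontier_both_sides:
  fixes A :: "real set"
  assumes "bounded A" "z \<in> A"
  shows "\<exists>s\<in>frontier A. s \<le> z" "\<exists>s\<in>frontier A. z \<le> s"
proof -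
  obtain B where B: "\<And>y. y \<in> A \<Longrightarrow> \<bar>y\<bar> \<le> B"
    using assms(1) by (auto simp: bounded_iff)
  have "{..z} \<inter> frontier A \<noteq> {}"
  proof (rule connected_Int_frontier)
    have "min z (- B - 1) \<in> {..z} - A"
      using B[of "min z (- B - 1)"] by (auto simp: min_def)
    then show "{..z} - A \<noteq> {}" by blast
  qed (use assms(2) in auto)
  moreover have "{z..} \<inter> frontier A \<noteq> {}"
  proof (rule connected_Int_frontier)
    have "max z (B + 1) \<in> {z..} - A"
      using B[of "max z (B + 1)"] by (auto simp: max_def)
    then show "{z..} - A \<noteq> {}" by blast
  qed (use assms(2) in auto)
  ultimately show "\<exists>s\<in>frontier A. s \<le> z" "\<exists>s\<in>frontier A. z \<le> s" by auto
qed

text \<open>Between consecutive boundary points each bubble is either everything or nothing, by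
  connectedness, and two bubbles cannot both be everything because their interiors are disjoint.
  A bubble has no points outside its pieces: near such a point it would contain an interval, hence
  another such point that is no boundary point; but as the bubble is bounded, that point lies between
  two boundary points and thus inside a piece.\<close>

lemma bubble_as_cells:
  assumes fiu: "\<And>a. a \<in> {1,2,3} \<Longrightarrow> finite_interval_union (E a)"
    and disj: "\<And>a b. a \<in> {1,2,3} \<Longrightarrow> b \<in> {1,2,3} \<Longrightarrow> a \<noteq> b \<Longrightarrow>
      interior (E a) \<inter> interior (E b) = {}"
    and ne: "E 1 \<noteq> {}"
  obtains w x where "\<And>n. n < length w \<Longrightarrow> x n < x (Suc n)"
    "x ` {..length w} = (\<Union>a\<in>{1,2,3}. frontier (E a))"
    "\<And>a. a \<in> {1,2,3::nat} \<Longrightarrow> E a = cells w x a"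
proof -
  define S where "S = (\<Union>a\<in>{1,2,3}. frontier (E a))"
  have S: "finite S" using fiu finite_interval_unionD(2) by (auto simp: S_def)
  obtain z0 where "z0 \<in> E 1" using ne by blast
  moreover have "bounded (E 1)" using fiu[of 1] by (simp add: finite_interval_unionD compact_imp_bounded)
  ultimately have "S \<noteq> {}" using frontier_both_sides(1)[of "E 1" z0] by (auto simp: S_def)
  define m where "m = card S - 1"
  have cardS: "card S = Suc m" using S \<open>S \<noteq> {}\<close> by (simp add: m_def card_gt_0_iff)
  define x where "x n = sorted_list_of_set S ! n" for n
  have len: "length (sorted_list_of_set S) = Suc m" by (simp add: cardS)
  have strict: "x i < x j" if "i < j" "j \<le> m" for i j
    unfolding x_def using that len strict_sorted_list_of_set[of S]
    by (intro sorted_wrt_nth_less[of "(<)"]) auto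
  have img: "x ` {..m} = S"
  proof -
    have "S = set (sorted_list_of_set S)" using S by simp
    also have "\<dots> = x ` {..<Suc m}"
      unfolding x_def set_conv_nth len by auto
    finally show ?thesis by (simp add: lessThan_Suc_atMost)
  qed
  have gap: "{x n<..<x (Suc n)} \<inter> S = {}" if "n < m" for n
  proof (rule ccontr)
    assume "{x n<..<x (Suc n)} \<inter> S \<noteq> {}"
    then obtain k where k: "k \<le> m" "x n < x k" "x k < x (Suc n)"
      unfolding img[symmetric] by auto
    show False
    proof (cases "k \<le> n")
      case True
      then show False using strict[of k n] k that by (cases "k = n") auto
    next
      case False
      then show False using strict[of "Suc n" k] k by (cases "k = Suc n") auto
    qed
  qed
  have sub: "{x n<..<x (Suc n)} \<subseteq> E a"
    if "n < m" "a \<in> {1,2,3}" "{x n<..<x (Suc n)} \<inter> E a \<noteq> {}" for n a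
  proof (rule ccontr)
    assume "\<not> {x n<..<x (Suc n)} \<subseteq> E a"
    then have "{x n<..<x (Suc n)} \<inter> frontier (E a) \<noteq> {}"
      using that by (intro connected_Int_frontier) auto
    then show False using gap[of n] that by (auto simp: S_def)
  qed
  define meets where "meets n a \<longleftrightarrow> a \<in> {1,2,3} \<and> {x n<..<x (Suc n)} \<inter> E a \<noteq> {}" for n a
  define lab where "lab n = (if \<exists>a. meets n a then SOME a. meets n a else 0)" for n
  have uniq: "a = b" if "n < m" "meets n a" "meets n b" for n a b
  proof (rule ccontr)
    assume "a \<noteq> b"
    have "{x n<..<x (Suc n)} \<subseteq> interior (E a) \<inter> interior (E b)"
      using sub[of n a] sub[of n b] that unfolding meets_def
      by (intro Int_greatest interior_maximal) auto
    then have "{x n<..<x (Suc n)} = {}"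
      using disj[of a b] \<open>a \<noteq> b\<close> that by (auto simp: meets_def)
    then show False using strict[of n "Suc n"] that by simp
  qed
  have lab: "lab n = a \<longleftrightarrow> meets n a" if "n < m" "a \<in> {1,2,3}" for n a
  proof
    assume "lab n = a"
    then have "\<exists>a. meets n a" using that by (auto simp: lab_def split: if_splits)
    then show "meets n a"
      using \<open>lab n = a\<close> someI_ex[of "meets n"] by (simp add: lab_def)
  next
    assume "meets n a"
    then show "lab n = a"
      using uniq[OF that(1)] someI[of "meets n" a] by (auto simp: lab_def)
  qed
  define w where "w = map lab [0..<m]"
  have w: "length w = m" "\<And>n. n < m \<Longrightarrow> w ! n = lab n" by (simp_all add: w_def)
  have "E a = cells w x a" if a: "a \<in> {1,2,3}" for a
  proof
    have cl: "compact (E a)" using fiu[OF a] by (rule finite_interval_unionD)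
    show "cells w x a \<subseteq> E a"
    proof -
      have "{x n..x (Suc n)} \<subseteq> E a" if "n < m" "meets n a" for n
      proof -
        have "closure {x n<..<x (Suc n)} \<subseteq> E a"
          using sub[of n a] that cl unfolding meets_def
          by (intro closure_minimal) (auto intro: compact_imp_closed)
        then show ?thesis using strict[of n "Suc n"] that by simp
      qed
      moreover have "meets n a" if "n < m" "w ! n = a" for n
        using lab[OF that(1) a] that w by simp
      ultimately show ?thesis
        unfolding cells_def w(1) by blast
    qed
    show "E a \<subseteq> cells w x a"
    proof (rule ccontr)
      assume "\<not> E a \<subseteq> cells w x a"
      then obtain y where y: "y \<in> E a" "y \<notin> cells w x a" by blast
      have "closed (cells w x a)" unfolding cells_def by (intro closed_UN) auto
      then have "open (- cells w x a)" by (simp add: open_Compl)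
      then obtain e where e: "0 < e" "ball y e \<subseteq> - cells w x a"
        using y(2) open_contains_ball[of "- cells w x a"] by auto
      obtain c d where cd: "c < d" "y \<in> {c..d}" "{c..d} \<subseteq> E a"
        using finite_interval_unionD(3)[OF fiu[OF a] y(1)] by blast
      \<comment> \<open>a point near the hypothetical extra point that lies in the bubble but is no boundary point\<close>
      have "infinite {max c (y - e)<..<min d (y + e)}"
        using cd e by (intro infinite_Ioo) auto
      then obtain z where z: "z \<in> {max c (y - e)<..<min d (y + e)}" "z \<notin> S"
        using S by (meson finite_subset subsetI)
      have "z \<in> ball y e" using z(1) by (auto simp: dist_real_def)
      then have zE: "z \<in> E a" "z \<notin> cells w x a" using z cd e by auto
      have "bounded (E a)" using cl by (rule compact_imp_bounded)
      from frontier_both_sides[OF this zE(1)] obtain s t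
        where st: "s \<in> S" "s \<le> z" "t \<in> S" "z \<le> t"
        using a unfolding S_def by blast
      then have "s < z" "z < t" using z(2) by (metis order_le_less)+
      obtain i j where ij: "i \<le> m" "s = x i" "j \<le> m" "t = x j"
        using st(1,3) unfolding img[symmetric] by blast
      define n where "n = Max {n. n \<le> m \<and> x n < z}"
      have fin: "finite {n. n \<le> m \<and> x n < z}" by simp
      have "n \<in> {n. n \<le> m \<and> x n < z}"
        unfolding n_def using ij(1,2) \<open>s < z\<close> by (intro Max_in) auto
      then have n: "n \<le> m" "x n < z" by auto
      have "n < j"
        using strict[of j n] n ij \<open>z < t\<close> by (cases n j rule: linorder_cases) auto
      then have nm: "n < m" using ij by simp
      have "\<not> x (Suc n) < z"
        using Max_ge[OF fin, of "Suc n"] nm unfolding n_def[symmetric] by auto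
      moreover have "x (Suc n) \<noteq> z" using z(2) img nm by auto
      ultimately have "z \<in> {x n<..<x (Suc n)}" using n by auto
      then have "meets n a" using zE a by (auto simp: meets_def)
      then have "w ! n = a" using lab[OF nm a] nm w by simp
      then have "z \<in> cells w x a"
        using \<open>z \<in> {x n<..<x (Suc n)}\<close> nm w by (force simp: cells_def)
      with zE show False by simp
    qed
  qed
  moreover have "x ` {..length w} = (\<Union>a\<in>{1,2,3}. frontier (E a))"
    using img w S_def by simp
  moreover have "x n < x (Suc n)" if "n < length w" for n
    using that strict w by simp
  ultimately show ?thesis using that by blast
qed

text \<open>A connected set that contains one of finitely many disjoint closed sets and is covered
  by them cannot meet the others.\<close>

lemma components_Union_disjoint_closed:
  assumes fin: "finite \<C>"
    and C: "\<And>C. C \<in> \<C> \<Longrightarrow> closed C \<and> connected C \<and> C \<noteq> {}"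
    and disj: "\<And>C D. C \<in> \<C> \<Longrightarrow> D \<in> \<C> \<Longrightarrow> C \<noteq> D \<Longrightarrow> C \<inter> D = {}"
  shows "components (\<Union>\<C>) = \<C>"
proof -
  have sub: "\<C> \<subseteq> components (\<Union>\<C>)"
  proof
    fix C assume "C \<in> \<C>"
    have "D = C" if D: "D \<noteq> {}" "C \<subseteq> D" "D \<subseteq> \<Union>\<C>" "connected D" for D
    proof (rule ccontr)
      assume "D \<noteq> C"
      let ?R = "\<Union>(\<C> - {C})"
      have "closed C" "closed ?R" using C \<open>C \<in> \<C>\<close> fin by (auto intro!: closed_Union)
      moreover have "D \<subseteq> C \<union> ?R" using D(3) by blast
      moreover have "C \<inter> ?R \<inter> D = {}" using disj \<open>C \<in> \<C>\<close> by blast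
      moreover have "C \<inter> D \<noteq> {}" using D(2) C \<open>C \<in> \<C>\<close> by blast
      moreover have "?R \<inter> D \<noteq> {}" using D(2,3) \<open>D \<noteq> C\<close> by blast
      ultimately show False using D(4) unfolding connected_closed by blast
    qed
    then show "C \<in> components (\<Union>\<C>)"
      unfolding in_components_maximal using C[OF \<open>C \<in> \<C>\<close>] \<open>C \<in> \<C>\<close>
      by (simp add: Union_upper)
  qed
  moreover have "components (\<Union>\<C>) \<subseteq> \<C>"
  proof
    fix D assume D: "D \<in> components (\<Union>\<C>)"
    then obtain y where "y \<in> D" using in_components_nonempty by blast
    then obtain C where "C \<in> \<C>" "y \<in> C" using D in_components_subset by blast
    then have "C = D" using sub D \<open>y \<in> D\<close> components_nonoverlap by blast
    with \<open>C \<in> \<C>\<close> show "D \<in> \<C>" by simp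
  qed
  ultimately show ?thesis by blast
qed

lemma components_cells:
  assumes strict: "\<And>n. n < length w \<Longrightarrow> x n < x (Suc n)"
    and adj: "\<And>n. Suc n < length w \<Longrightarrow> w ! n \<noteq> w ! Suc n"
  shows "components (cells w x a) = {{x n..x (Suc n)} | n. n < length w \<and> w ! n = a}"
proof -
  let ?C = "{{x n..x (Suc n)} | n. n < length w \<and> w ! n = a}"
  have sep: "x (Suc n) < x k" if "n < k" "k < length w" "w ! n = a" "w ! k = a" for n k
  proof -
    have "Suc n \<noteq> k" using adj[of n] that by auto
    then show ?thesis using that by (intro chain_strict_mono[of "length w" x, OF strict]) auto
  qed
  have "cells w x a = \<Union>?C"
    using strict by (auto simp: cells_def)
  moreover have "components (\<Union>?C) = ?C"
  proof (rule components_Union_disjoint_closed)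
    fix C assume "C \<in> ?C"
    then obtain n where "n < length w" "C = {x n..x (Suc n)}" by blast
    then show "closed C \<and> connected C \<and> C \<noteq> {}" using strict[of n] by auto
  next
    fix C D assume "C \<in> ?C" "D \<in> ?C" "C \<noteq> D"
    then obtain n k where nk: "n < length w" "w ! n = a" "C = {x n..x (Suc n)}"
      "k < length w" "w ! k = a" "D = {x k..x (Suc k)}" "n \<noteq> k" by blast
    then show "C \<inter> D = {}"
      using sep[of n k] sep[of k n] by (cases n k rule: linorder_cases) auto
  qed auto
  ultimately show ?thesis by simp
qed

section \<open>The form of minimizing triple bubbles\<close>

theorem proposition3p3:
  fixes f :: "real \<Rightarrow> real" and V :: "nat \<Rightarrow> real" and E :: "nat \<Rightarrow> real set"
  assumes "continuous_on UNIV f"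
    and "\<forall>x. f x > 0"
    and "antimono_on {..0} f"
    and "mono_on {0..} f"
    and "0 < V 1" and "V 1 \<le> V 2" and "V 2 \<le> V 3"
    and "perimeter_minimizing f V E"
  shows "\<exists>w \<in> {[2,1,3], [1,2,3], [1,3,2],
               [3,1,2,3], [2,1,3,2],
               [2,3,1,3], [1,3,2,3], [3,2,1,2],
               [3,2,1,2,3], [2,3,1,3,2]}. has_form_up_to_reflection E w"
proof -
  have anti: "f y \<le> f x" if "x \<le> y" "y \<le> 0" for x y
    using assms(3) that by (auto simp: monotone_on_def)
  have mono: "f x \<le> f y" if "0 \<le> x" "x \<le> y" for x y
    using assms(4) that by (auto simp: monotone_on_def)
  have pos: "f x > 0" for x using assms(2) by blast
  have "f 0 \<le> f x" for x
    using anti[of x 0] mono[of 0 x] by (cases "x \<le> 0") auto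
  from volume_coordinate[OF assms(1) pos[of 0] this]
  obtain F where F: "F 0 = 0" "strict_mono F" "surj F"
    "\<And>a b. a \<le> b \<Longrightarrow> (f has_integral (F b - F a)) {a..b}"
    by blast
  define G where "G = inv F"
  have GF: "G (F x) = x" for x
    unfolding G_def using F(2) by (simp add: strict_mono_imp_inj_on)
  have FG: "F (G v) = v" for v
    unfolding G_def using F(3) by (rule surj_f_inv_f)
  have G_mono: "G u \<le> G v" if "u \<le> v" for u v
    using that strict_mono_less_eq[OF F(2), of "G u" "G v"] by (simp add: FG)
  have G0: "G 0 = 0" using GF[of 0] F(1) by simp
  interpret valley "f \<circ> G"
  proof
    show "(f \<circ> G) x > 0" for x by (simp add: pos)
    show "(f \<circ> G) y \<le> (f \<circ> G) x" if "x \<le> y" "y \<le> 0" for x y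
      using anti[of "G x" "G y"] G_mono[OF that(1)] G_mono[OF that(2)] G0 by simp
    show "(f \<circ> G) x \<le> (f \<circ> G) y" if "0 \<le> x" "x \<le> y" for x y
      using mono[of "G x" "G y"] G_mono[OF that(1)] G_mono[OF that(2)] G0 by simp
  qed
  have E: "triple_bubble f V E" "\<And>E'. triple_bubble f V E' \<Longrightarrow> perimeter f E \<le> perimeter f E'"
    using assms(8) unfolding perimeter_minimizing_def by blast+
  have fiu: "finite_interval_union (E a)" "volume f (E a) = V a" if "a \<in> {1,2,3}" for a
    using E(1) that unfolding triple_bubble_def by blast+
  have disj: "interior (E a) \<inter> interior (E b) = {}"
    if "a \<in> {1,2,3}" "b \<in> {1,2,3}" "a \<noteq> b" for a b
    using E(1) that unfolding triple_bubble_def by blast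
  have "E 1 \<noteq> {}"
    using fiu(2)[of 1] assms(5) by (auto simp: volume_def)
  from bubble_as_cells[of E, OF fiu(1) disj this] obtain w x where
    strict: "\<And>n. n < length w \<Longrightarrow> x n < x (Suc n)"
    and front: "x ` {..length w} = (\<Union>a\<in>{1,2,3}. frontier (E a))"
    and cells: "\<And>a. a \<in> {1,2,3::nat} \<Longrightarrow> E a = cells w x a"
    by blast
  have vol: "vol w (F \<circ> x) a = V a" if "a \<in> {1,2,3}" for a
  proof -
    have "(f has_integral vol w (F \<circ> x) a) (E a)"
      unfolding cells[OF that] using strict F(4) by (intro has_integral_cells) (auto intro: less_imp_le)
    then show ?thesis using fiu(2)[OF that] by (simp add: volume_def integral_unique)
  qed
  have min: "minimal (f \<circ> G) w (F \<circ> x)"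
    unfolding minimal_def
  proof (intro conjI allI impI)
    show "(F \<circ> x) n < (F \<circ> x) (Suc n)" if "n < length w" for n
      using strict[OF that] F(2) by (simp add: strict_monoD)
    fix q assume q: "\<forall>n<length w. q n \<le> q (Suc n)" "\<forall>a\<in>{1,2,3}. vol w q a = vol w (F \<circ> x) a"
    have Fq: "F \<circ> (G \<circ> q) = q" by (simp add: fun_eq_iff FG)
    have q_mono: "(G \<circ> q) n \<le> (G \<circ> q) (Suc n)" if "n < length w" for n
      using q(1) that G_mono by simp
    have q_vol: "vol w (F \<circ> (G \<circ> q)) a = V a" if "a \<in> {1,2,3}" for a
      unfolding Fq using q(2) vol that by auto
    have nonneg: "0 \<le> f y" for y using assms(2) by (simp add: less_imp_le)
    note comp = cells_competitor[of w "G \<circ> q" f F V, OF q_mono F(4) q_vol nonneg]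
    have "inj_on x {..length w}"
    proof (rule linorder_inj_onI)
      fix i j assume "i < j" "i \<in> {..length w}" "j \<in> {..length w}"
      then show "x i \<noteq> x j" using chain_strict_mono[of "length w" x i j, OF strict] by auto
    qed auto
    then have "(\<Sum>n\<le>length w. (f \<circ> G) ((F \<circ> x) n)) = (\<Sum>y\<in>x ` {..length w}. f y)"
      by (simp add: sum.reindex GF)
    also have "\<dots> = perimeter f E" by (simp add: front perimeter_def)
    also have "\<dots> \<le> perimeter f (cells w (G \<circ> q))" by (rule E(2), rule comp)
    also have "\<dots> \<le> (\<Sum>y\<in>(G \<circ> q) ` {..length w}. f y)" by (rule comp)
    also have "(G \<circ> q) ` {..length w} = G ` (q ` {..length w})" by (simp add: image_comp)
    also have "(\<Sum>y\<in>G ` (q ` {..length w}). f y) = (\<Sum>v\<in>q ` {..length w}. (f \<circ> G) v)"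
    proof (rule sum.reindex)
      show "inj_on G (q ` {..length w})" by (rule inj_on_inverseI[of _ F]) (rule FG)
    qed
    finally show "(\<Sum>n\<le>length w. (f \<circ> G) ((F \<circ> x) n)) \<le> (\<Sum>v\<in>q ` {..length w}. (f \<circ> G) v)" .
  qed
  then have "w \<in> set forms \<or> rev w \<in> set forms"
    using vol assms(5-7) by (intro minimal_word) auto
  moreover have "has_form E w"
    unfolding has_form_def
  proof (rule exI[of _ x], intro conjI allI impI ballI)
    fix a :: nat assume "a \<in> {1,2,3}"
    then show "components (E a) = {{x j..x (Suc j)} | j. j < length w \<and> w ! j = a}"
      unfolding cells[OF \<open>a \<in> {1,2,3}\<close>]
      by (intro components_cells strict adjacent_distinct[OF min])
  qed (rule strict)
  ultimately have "\<exists>w \<in> set forms. has_form_up_to_reflection E w"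
    unfolding has_form_up_to_reflection_def by (metis rev_rev_ident)
  then show ?thesis by (simp add: forms_def)
qed

end
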